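(* Let $n$ be an integer greater than $1$. The map $\Phi\colon\mathcal{C}_n^+/\mathrm{SL}_2(\mathbb{Z})\longrightarrow \mathbf{FR}_n^+$, which sends the $\mathrm{SL}_2(\mathbb{Z})$-orbit of a clockwise simple closed path of length $n$ in the Farey graph (extended to an $n$-periodic bi-infinite path with suitably normalised vertices $a_i/b_i$) to $\pm\mathbf{M}$, where $m_{i,j}=a_jb_i-b_ja_i$, is a one-to-one correspondence (a bijection).
   Context: An $\mathrm{SL}_2$-tiling is a function $\mathbf{M}\colon\mathbb{Z}\times\mathbb{Z}\to\mathbb{Z}$, with $m_{i,j}=\mathbf{M}(i,j)$, such that $m_{i,j}m_{i+1,j+1}-m_{i,j+1}m_{i+1,j}=1$ for all $i,j\in\mathbb{Z}$. It is tame if every $3\times 3$ submatrix of consecutive rows and columns has determinant $0$. A tame frieze of order $n$ is a tame $\mathrm{SL}_2$-tiling $\mathbf{M}$ such that $m_{i,i}=m_{i+n,i}=0$ for all $i\in\mathbb{Z}$; it is a positive frieze of order $n$ if moreover $m_{i,j}>0$ whenever $0<i-j<n$. $\mathbf{FR}_n$ is the set of tame friezes of order $n$ with $\mathbf{M}$ and $-\mathbf{M}$ identified, and $\mathbf{FR}_n^+$ is the set of positive friezes of order $n$, regarded as a subset of $\mathbf{FR}_n$ via $\mathbf{M}\mapsto\pm\mathbf{M}$. A reduced rational is an expression $a/b$ with $a,b$ coprime integers, where $1/0$ and $(-1)/0$ are allowed and both represent $\infty$. The Farey graph $\mathcal{F}$ has vertex set $\mathbb{Q}_\infty=\mathbb{Q}\cup\{\infty\}$,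 with reduced rationals $a/b$ and $c/d$ adjacent if and only if $ad-bc=\pm1$. A closed path of length $n$ in $\mathcal{F}$ is a sequence $\langle v_0,v_1,\dots,v_n\rangle$ of vertices with $v_i$ adjacent to $v_{i+1}$ for $0\leq i<n$ and $v_0=v_n$; it is simple if $v_0,\dots,v_{n-1}$ are distinct. Identify $\mathbb{R}_\infty=\mathbb{R}\cup\{\infty\}$ with the unit circle by $z\mapsto(iz+1)/(z+i)$ (so $\infty\mapsto i$, $1\mapsto1$, $0\mapsto-i$, $-1\mapsto-1$; decreasing along $\mathbb{R}$ is clockwise). A simple closed path is clockwise if $v_0,v_1,\dots,v_{n-1}$ is in clockwise order, meaning that for all $0\leq i<j<k\leq n-1$ the images of $v_i,v_j,v_k$ are in clockwise order around the unit circle. $\mathcal{C}_n^+$ is the set of clockwise simple closed paths of length $n$ in $\mathcal{F}$. A closed path of length $n$ is identified with the bi-infinite path $\langle\dots,v_{-1},v_0,v_1,v_2,\dots\rangle$ with $v_i=v_j$ whenever $i\equiv j\pmod n$. $\mathrm{SL}_2(\mathbb{Z})$ acts on $\mathbb{Q}_\infty$ by Möbius transformations $z\mapsto\frac{az+b}{cz+d}$, preserving adjacency and clockwise order, hence acts vertexwise on $\mathcal{C}_n^+$. Given a bi-infinite path $\gamma$, write its vertices as reduced rationals $v_i=a_i/b_i$ with $a_ib_{i+1}-a_{i+1}b_i=1$ for all $i\in\mathbb{Z}$ (possible in exactly two ways, differing by a global sign), and put $m_{i,j}=a_jb_i-b_ja_i$. The resulting $\pm\mathbf{M}$ depends only on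 the $\mathrm{SL}_2(\mathbb{Z})$-orbit of $\gamma$; this is $\Phi$ of that orbit. *)

theory Defs
  imports "HOL-Analysis.Analysis"
begin

section \<open>Tame and positive friezes\<close>

type_synonym tiling = "int \<Rightarrow> int \<Rightarrow> int"

definition SL2_tiling :: "tiling \<Rightarrow> bool" where
  "SL2_tiling M \<longleftrightarrow>
     (\<forall>i j. M i j * M (i + 1) (j + 1) - M i (j + 1) * M (i + 1) j = 1)"

definition tame :: "tiling \<Rightarrow> bool" where
  "tame M \<longleftrightarrow> (\<forall>i j. det (vector
     [vector [M i j,       M i (j + 1),       M i (j + 2)],
      vector [M (i + 1) j, M (i + 1) (j + 1), M (i + 1) (j + 2)],
      vector [M (i + 2) j, M (i + 2) (j + 1), M (i + 2) (j + 2)]] :: int^3^3) = 0)"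

definition tame_frieze :: "nat \<Rightarrow> tiling \<Rightarrow> bool" where
  "tame_frieze n M \<longleftrightarrow> SL2_tiling M \<and> tame M \<and> (\<forall>i. M i i = 0 \<and> M (i + int n) i = 0)"

definition positive_frieze :: "nat \<Rightarrow> tiling \<Rightarrow> bool" where
  "positive_frieze n M \<longleftrightarrow>
     tame_frieze n M \<and> (\<forall>i j. 0 < i - j \<and> i - j < int n \<longrightarrow> 0 < M i j)"

definition up_to_sign :: "tiling \<Rightarrow> tiling set" where
  "up_to_sign M = {M, (\<lambda>i j. - M i j)}"

definition FR :: "nat \<Rightarrow> tiling set set" where
  "FR n = up_to_sign ` {M. tame_frieze n M}"

definition FR_plus :: "nat \<Rightarrow> tiling set set" where
  "FR_plus n = up_to_sign ` {M. positive_frieze n M}"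

lemma FR_plus_subset_FR: "FR_plus n \<subseteq> FR n"
  by (auto simp: FR_def FR_plus_def positive_frieze_def)


section \<open>The Farey graph\<close>

text \<open>The one-point extensions of the rationals and of the reals are the types
  \<^typ>\<open>rat option\<close> and \<^typ>\<open>real option\<close>, with \<^term>\<open>None\<close> in the role of infinity.\<close>

definition reduced_rational :: "int \<Rightarrow> int \<Rightarrow> rat option \<Rightarrow> bool" where
  "reduced_rational a b v \<longleftrightarrow>
     coprime a b \<and> v = (if b = 0 then None else Some (of_int a / of_int b))"

definition farey_adjacent :: "rat option \<Rightarrow> rat option \<Rightarrow> bool" where
  "farey_adjacent u v \<longleftrightarrow>
     (\<exists>a b c d. reduced_rational a b u \<and> reduced_rational c d v \<and> \<bar>a * d - b * c\<bar> = 1)"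

text \<open>A closed path of length \<open>n\<close> is the list of its \<open>n + 1\<close> vertices, the first of which is
  repeated at the end.\<close>

definition farey_closed_path :: "nat \<Rightarrow> rat option list \<Rightarrow> bool" where
  "farey_closed_path n vs \<longleftrightarrow>
     length vs = n + 1 \<and> (\<forall>i<n. farey_adjacent (vs ! i) (vs ! (i + 1))) \<and> vs ! 0 = vs ! n"

definition simple_closed_path :: "nat \<Rightarrow> rat option list \<Rightarrow> bool" where
  "simple_closed_path n vs \<longleftrightarrow> farey_closed_path n vs \<and> distinct (take n vs)"

definition circle_point :: "real option \<Rightarrow> complex" where
  "circle_point z =
     (case z of None \<Rightarrow> \<i>
      | Some x \<Rightarrow> (\<i> * complex_of_real x + 1) / (complex_of_real x + \<i>))"

text \<open>Three points of the unit circle are in clockwise order if they are met in this order when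
  the argument decreases through less than a full turn.\<close>

definition clockwise_order :: "complex \<Rightarrow> complex \<Rightarrow> complex \<Rightarrow> bool" where
  "clockwise_order p q r \<longleftrightarrow>
     (\<exists>\<alpha> \<beta> \<gamma>. p = cis \<alpha> \<and> q = cis \<beta> \<and> r = cis \<gamma> \<and> \<alpha> > \<beta> \<and> \<beta> > \<gamma> \<and> \<gamma> > \<alpha> - 2 * pi)"

definition clockwise_path :: "nat \<Rightarrow> rat option list \<Rightarrow> bool" where
  "clockwise_path n vs \<longleftrightarrow>
     (\<forall>i j k. i < j \<and> j < k \<and> k < n \<longrightarrow>
        clockwise_order (circle_point (map_option of_rat (vs ! i)))
                        (circle_point (map_option of_rat (vs ! j)))
                        (circle_point (map_option of_rat (vs ! k))))"

definition C_plus :: "nat \<Rightarrow> rat option list set" where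
  "C_plus n = {vs. simple_closed_path n vs \<and> clockwise_path n vs}"


section \<open>The action of the modular group\<close>

definition SL2Z :: "(int^2^2) set" where
  "SL2Z = {A. det A = 1}"

fun moebius :: "int^2^2 \<Rightarrow> rat option \<Rightarrow> rat option" where
  "moebius A None =
     (if A$2$1 = 0 then None else Some (of_int (A$1$1) / of_int (A$2$1)))"
| "moebius A (Some z) =
     (if of_int (A$2$1) * z + of_int (A$2$2) = 0 then None
      else Some ((of_int (A$1$1) * z + of_int (A$1$2)) / (of_int (A$2$1) * z + of_int (A$2$2))))"

definition SL2Z_orbit :: "rat option list \<Rightarrow> rat option list set" where
  "SL2Z_orbit vs = {map (moebius A) vs |A. A \<in> SL2Z}"

definition C_plus_mod_SL2Z :: "nat \<Rightarrow> rat option list set set" where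
  "C_plus_mod_SL2Z n = SL2Z_orbit ` C_plus n"


section \<open>The correspondence\<close>

definition bi_infinite :: "nat \<Rightarrow> rat option list \<Rightarrow> int \<Rightarrow> rat option" where
  "bi_infinite n vs i = vs ! nat (i mod int n)"

definition normalised_lifts :: "(int \<Rightarrow> rat option) \<Rightarrow> ((int \<Rightarrow> int) \<times> (int \<Rightarrow> int)) set" where
  "normalised_lifts v =
     {(a, b). \<forall>i. reduced_rational (a i) (b i) (v i) \<and> a i * b (i + 1) - a (i + 1) * b i = 1}"

text \<open>As usual for functions on quotients, the value at an orbit is the union of the values
  obtained from all representatives, here from all paths in the orbit and all normalised lifts.
  An element of \<^term>\<open>FR n\<close> is a set \<open>{M, -M}\<close>, so a value in \<^term>\<open>FR n\<close> means that a
  normalised lift exists and that \<open>M\<close> is, up to sign, independent of both choices.\<close>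

definition \<Phi> :: "nat \<Rightarrow> rat option list set \<Rightarrow> tiling set" where
  "\<Phi> n X = (\<Union>vs\<in>X. \<Union>(a, b)\<in>normalised_lifts (bi_infinite n vs).
               up_to_sign (\<lambda>i j. a j * b i - b j * a i))"

end

theory Submission
  imports Defs
begin

text \<open>Let \<open>w i = (a i, b i)\<close> be a normalised lift, so that \<open>M i j\<close> is the determinant of \<open>w j\<close> and
  \<open>w i\<close>. Three vertices are in clockwise order iff the product of the three determinants of their
  lifts has a fixed sign; since consecutive determinants are \<open>1\<close>, induction on \<open>i - j\<close> shows that a
  clockwise path has \<open>M i j > 0\<close> for \<open>0 \<le> j < i < n\<close>. As \<open>w (i + n) = s w i\<close> with a global sign \<open>s\<close>,
  the value \<open>M n (n - 1) = 1\<close> forces \<open>s = - 1\<close>, and this antiperiodicity extends positivity to the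
  whole strip. Conversely, tameness means that the columns of a frieze satisfy a second-order linear
  recurrence, so \<open>M\<close> is recovered from its columns \<open>0\<close> and \<open>1\<close>, which form a lift of the desired
  path. Two lifts with the same determinants differ by an element of \<open>SL\<^sub>2(\<int>)\<close>, whence injectivity.\<close>

section \<open>Reduced rationals\<close>

text \<open>Bezout coefficients of \<open>a\<close> and \<open>b\<close> turn the vanishing
  determinant into an explicit factor \<open>s\<close>, which divides both \<open>c\<close> and
  \<open>d\<close> and hence is a unit.\<close>

lemma coprime_proportional:
  fixes a b c d :: int
  assumes "coprime a b" "coprime c d" "a * d = b * c"
  obtains s where "s = 1 \<or> s = - 1" "c = s * a" "d = s * b"
proof -
  obtain x y where xy: "x * a + y * b = 1"
    using \<open>coprime a b\<close> by (metis bezout_int coprime_iff_gcd_eq_1)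
  define s where "s = x * c + y * d"
  have "s * a = (x * a + y * b) * c" "s * b = (x * a + y * b) * d"
    using assms(3) by (simp_all add: s_def algebra_simps)
  then have cd: "c = s * a" "d = s * b" by (simp_all add: xy)
  then have "is_unit s"
    using \<open>coprime c d\<close> by (metis coprime_common_divisor dvd_triv_left)
  then have "s = 1 \<or> s = - 1" by (simp add: zdvd1_eq abs_if split: if_splits)
  with cd show ?thesis using that by blast
qed

lemma reduced_rational_exists: "\<exists>a b. reduced_rational a b v"
proof (cases v)
  case None
  then have "reduced_rational 1 0 v" by (simp add: reduced_rational_def)
  then show ?thesis by blast
next
  case (Some q)
  obtain a b where ab: "quotient_of q = (a, b)" by force
  then have "reduced_rational a b v"
    using quotient_of_denom_pos[OF ab] quotient_of_coprime[OF ab] quotient_of_div[OF ab] Some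
    by (simp add: reduced_rational_def)
  then show ?thesis by blast
qed

lemma reduced_rational_fun:
  assumes "reduced_rational a b u" "reduced_rational a b v"
  shows "u = v"
  using assms by (simp add: reduced_rational_def)

lemma reduced_rational_sign:
  assumes "reduced_rational a b v" "s = 1 \<or> s = - 1"
  shows "reduced_rational (s * a) (s * b) v"
  using assms by (auto simp: reduced_rational_def)

lemma reduced_rational_unique:
  assumes ab: "reduced_rational a b v" and cd: "reduced_rational c d v"
  obtains s where "s = 1 \<or> s = - 1" "c = s * a" "d = s * b"
proof -
  have "a * d = b * c"
  proof (cases "b = 0")
    case True
    with ab cd show ?thesis by (auto simp: reduced_rational_def split: if_splits)
  next
    case False
    with ab cd have "d \<noteq> 0" "of_int a / of_int b = (of_int c / of_int d :: rat)"
      by (auto simp: reduced_rational_def split: if_splits)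
    with False have "of_int (a * d) = (of_int (b * c) :: rat)"
      by (simp add: field_simps)
    then show ?thesis by (simp only: of_int_eq_iff)
  qed
  then show ?thesis
    using coprime_proportional ab cd that unfolding reduced_rational_def by metis
qed

text \<open>Adjacency only asks for some representatives; changing their signs keeps the absolute
  value of the determinant, so any representatives may be used.\<close>

lemma farey_adjacent_reduced:
  assumes "farey_adjacent u v" "reduced_rational a b u" "reduced_rational c d v"
  shows "\<bar>a * d - b * c\<bar> = 1"
proof -
  obtain a' b' c' d' where *: "reduced_rational a' b' u" "reduced_rational c' d' v"
    "\<bar>a' * d' - b' * c'\<bar> = 1"
    using assms(1) by (auto simp: farey_adjacent_def)
  obtain s where s: "s = 1 \<or> s = - 1" "a = s * a'" "b = s * b'"
    using reduced_rational_unique[OF *(1) assms(2)] .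
  obtain t where t: "t = 1 \<or> t = - 1" "c = t * c'" "d = t * d'"
    using reduced_rational_unique[OF *(2) assms(3)] .
  show ?thesis using s t *(3) by auto
qed

lemma coprime_if_det_1:
  fixes a b c d :: int
  assumes "a * d - c * b = 1"
  shows "coprime a b"
proof -
  have "gcd a b dvd a * d - c * b" by (simp add: dvd_diff)
  with assms show ?thesis by (simp add: coprime_iff_gcd_eq_1)
qed


section \<open>Moebius transformations\<close>

text \<open>On representatives the action is linear, which spares later arguments the case of
  infinity.\<close>

lemma moebius_reduced:
  assumes A: "A \<in> SL2Z" and ab: "reduced_rational a b v"
  shows "reduced_rational (A$1$1 * a + A$1$2 * b) (A$2$1 * a + A$2$2 * b) (moebius A v)"
proof -
  have det: "A$1$1 * A$2$2 - A$1$2 * A$2$1 = 1"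
    using A by (simp add: SL2Z_def det_2)
  have cop: "coprime a b" using ab by (simp add: reduced_rational_def)
  have "coprime (A$1$1 * a + A$1$2 * b) (A$2$1 * a + A$2$2 * b)"
  proof (rule coprimeI)
    fix g assume g: "g dvd A$1$1 * a + A$1$2 * b" "g dvd A$2$1 * a + A$2$2 * b"
    \<comment> \<open>Multiplying by the adjugate of \<open>A\<close> recovers \<open>a\<close> and
      \<open>b\<close>, so a common divisor of the image coordinates divides both.\<close>
    have "A$2$2 * (A$1$1 * a + A$1$2 * b) - A$1$2 * (A$2$1 * a + A$2$2 * b)
        = (A$1$1 * A$2$2 - A$1$2 * A$2$1) * a"
      "A$1$1 * (A$2$1 * a + A$2$2 * b) - A$2$1 * (A$1$1 * a + A$1$2 * b)
        = (A$1$1 * A$2$2 - A$1$2 * A$2$1) * b"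
      by (simp_all add: algebra_simps)
    with g have "g dvd a" "g dvd b"
      unfolding det by (metis dvd_diff dvd_mult mult_1)+
    with cop show "is_unit g" using coprime_common_divisor by blast
  qed
  moreover have "moebius A v = (if A$2$1 * a + A$2$2 * b = 0 then None
      else Some (of_int (A$1$1 * a + A$1$2 * b) / of_int (A$2$1 * a + A$2$2 * b)))"
  proof (cases "b = 0")
    case True
    then have "a = 1 \<or> a = - 1" "v = None"
      using ab by (auto simp: reduced_rational_def)
    with True show ?thesis by auto
  next
    case False
    then have v: "v = Some (of_int a / of_int b)" using ab by (simp add: reduced_rational_def)
    have *: "of_int x * (of_int a / of_int b) + of_int y = (of_int (x * a + y * b) / of_int b :: rat)"
      for x y using False by (simp add: field_simps)
    show ?thesis unfolding v moebius.simps * using False by (simp del: of_int_add of_int_mult)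
  qed
  ultimately show ?thesis by (simp add: reduced_rational_def)
qed

lemma SL2Z_mult: "A \<in> SL2Z \<Longrightarrow> B \<in> SL2Z \<Longrightarrow> A ** B \<in> SL2Z"
  by (simp add: SL2Z_def det_mul)

lemma moebius_mult:
  assumes "A \<in> SL2Z" "B \<in> SL2Z"
  shows "moebius (A ** B) v = moebius A (moebius B v)"
proof -
  obtain a b where ab: "reduced_rational a b v" using reduced_rational_exists by blast
  note AB = moebius_reduced[OF SL2Z_mult[OF assms] ab]
  note A_B = moebius_reduced[OF assms(1) moebius_reduced[OF assms(2) ab]]
  show ?thesis
    by (rule reduced_rational_fun[OF AB])
      (use A_B in \<open>simp add: matrix_matrix_mult_def sum_2 algebra_simps\<close>)
qed

lemma moebius_one: "moebius (mat 1) v = v"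
  by (cases v) (simp_all add: mat_def)

lemma self_in_SL2Z_orbit: "vs \<in> SL2Z_orbit vs"
proof -
  have "vs = map (moebius (mat 1)) vs" by (rule map_idI[symmetric]) (rule moebius_one)
  moreover have "mat 1 \<in> SL2Z" by (simp add: SL2Z_def)
  ultimately show ?thesis unfolding SL2Z_orbit_def by blast
qed

text \<open>Applied in both directions, this gives equality of orbits without inverting
  matrices.\<close>

lemma SL2Z_orbit_subset:
  assumes "us \<in> SL2Z_orbit vs"
  shows "SL2Z_orbit us \<subseteq> SL2Z_orbit vs"
proof
  fix ws assume "ws \<in> SL2Z_orbit us"
  with assms obtain A B where AB: "A \<in> SL2Z" "B \<in> SL2Z"
    "us = map (moebius A) vs" "ws = map (moebius B) us"
    by (auto simp: SL2Z_orbit_def)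
  then have "ws = map (moebius (B ** A)) vs" by (simp add: moebius_mult)
  with AB show "ws \<in> SL2Z_orbit vs"
    unfolding SL2Z_orbit_def using SL2Z_mult by blast
qed


section \<open>Clockwise order\<close>

text \<open>If \<open>(a, b)\<close> has polar angle \<open>\<theta>\<close>, then \<open>a / b\<close> is sent to
  \<open>(b + \<i>a) / (a + \<i>b) = \<i> cis (- 2\<theta>)\<close>, so that \<open>\<alpha> = \<pi>/2 - 2\<theta>\<close>. The number \<open>r\<close> below may be
  negative.\<close>

lemma circle_point_eq_cis_iff:
  assumes "reduced_rational a b v"
  shows "circle_point (map_option of_rat v) = cis \<alpha> \<longleftrightarrow>
    (\<exists>r. r \<noteq> 0 \<and> of_int a = r * cos (pi / 4 - \<alpha> / 2) \<and> of_int b = r * sin (pi / 4 - \<alpha> / 2))"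
    (is "?L \<longleftrightarrow> ?R")
proof -
  define \<theta> where "\<theta> = pi / 4 - \<alpha> / 2"
  define z where "z = Complex (of_int a) (of_int b)"
  have ab: "a \<noteq> 0 \<or> b \<noteq> 0" using assms by (auto simp: reduced_rational_def)
  then have z0: "z \<noteq> 0" by (simp add: z_def complex_eq_iff)
  \<comment> \<open>This form also covers infinity, where \<open>z\<close> is real and
    nonzero.\<close>
  have cp: "circle_point (map_option of_rat v) = \<i> * cnj z / z"
  proof (cases "b = 0")
    case True
    then have "cnj z = z" by (simp add: z_def complex_eq_iff)
    with z0 True assms show ?thesis
      by (simp add: circle_point_def reduced_rational_def)
  next
    case False
    then have v: "v = Some (of_int a / of_int b)" using assms by (simp add: reduced_rational_def)
    define x :: real where "x = of_int a / of_int b"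
    have "z = of_int b * (of_real x + \<i>)" "\<i> * cnj z = of_int b * (\<i> * of_real x + 1)"
      using False by (simp_all add: z_def x_def complex_eq_iff)
    then show ?thesis
      using False by (simp add: v circle_point_def x_def of_rat_divide)
  qed
  have "cis \<alpha> = \<i> * cis (- \<theta>) * cis (- \<theta>)"
    by (simp add: \<theta>_def cis_mult complex_eq_iff cos_diff sin_diff flip: cis_pi_half)
  then have "?L \<longleftrightarrow> cnj z = cis (- \<theta>) * cis (- \<theta>) * z"
    unfolding cp using z0 by (simp add: field_simps)
  \<comment> \<open>The condition now says that \<open>z\<close>, rotated by
    \<open>- \<theta>\<close>, is real, that is, \<open>z\<close> lies on the line through the
    origin at angle \<open>\<theta>\<close>.\<close>
  also have "\<dots> \<longleftrightarrow> cnj (cis (- \<theta>) * z) = cis (- \<theta>) * z"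
  proof -
    have "cis (- \<theta>) * cis \<theta> = 1" by (simp add: cis_mult)
    then have "cnj z = cis (- \<theta>) * cis (- \<theta>) * z \<longleftrightarrow> cis \<theta> * cnj z = cis (- \<theta>) * z"
      by (metis mult.assoc mult.commute mult_1)
    then show ?thesis by (simp add: cis_cnj)
  qed
  also have "\<dots> \<longleftrightarrow> (\<exists>r. cis (- \<theta>) * z = of_real r)"
    by (metis Reals_cases Reals_cnj_iff Reals_of_real)
  also have "\<dots> \<longleftrightarrow> (\<exists>r. z = of_real r * cis \<theta>)"
  proof -
    have "cis (- \<theta>) * cis \<theta> = 1" by (simp add: cis_mult)
    then have "cis (- \<theta>) * z = of_real r \<longleftrightarrow> z = of_real r * cis \<theta>" for r
      by (metis mult.assoc mult.commute mult_1)
    then show ?thesis by simp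
  qed
  also have "\<dots> \<longleftrightarrow> (\<exists>r. r \<noteq> 0 \<and> z = of_real r * cis \<theta>)"
    using z0 by auto
  also have "\<dots> \<longleftrightarrow> ?R"
    by (simp add: z_def complex_eq_iff \<theta>_def)
  finally show ?thesis .
qed

lemma polar_det:
  fixes r s :: real
  shows "(r * cos \<theta>) * (s * sin \<psi>) - (s * cos \<psi>) * (r * sin \<theta>) = r * s * sin (\<psi> - \<theta>)"
  by (simp add: sin_diff algebra_simps)

text \<open>Each lift enters the product twice, so its unknown sign cancels; what remains are sines
  of half the gaps between \<open>\<alpha>\<close>, \<open>\<beta>\<close>, \<open>\<gamma>\<close>,
  which lie between 0 and \<open>pi\<close>.\<close>

lemma clockwise_order_imp_det:
  assumes red: "reduced_rational a b u" "reduced_rational c d v" "reduced_rational e f w"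
    and "clockwise_order (circle_point (map_option of_rat u)) (circle_point (map_option of_rat v))
      (circle_point (map_option of_rat w))"
  shows "(a * d - c * b) * (c * f - e * d) * (a * f - e * b) > 0"
proof -
  obtain \<alpha> \<beta> \<gamma> where cis: "circle_point (map_option of_rat u) = cis \<alpha>"
    "circle_point (map_option of_rat v) = cis \<beta>" "circle_point (map_option of_rat w) = cis \<gamma>"
    and ord: "\<alpha> > \<beta>" "\<beta> > \<gamma>" "\<gamma> > \<alpha> - 2 * pi"
    using assms(4) by (auto simp: clockwise_order_def)
  define \<theta> \<psi> \<phi> where "\<theta> = pi / 4 - \<alpha> / 2" "\<psi> = pi / 4 - \<beta> / 2" "\<phi> = pi / 4 - \<gamma> / 2"
  note angles = this
  obtain r where r: "r \<noteq> 0" "of_int a = r * cos \<theta>" "of_int b = r * sin \<theta>"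
    using cis(1) unfolding circle_point_eq_cis_iff[OF red(1)] angles by blast
  obtain s where s: "s \<noteq> 0" "of_int c = s * cos \<psi>" "of_int d = s * sin \<psi>"
    using cis(2) unfolding circle_point_eq_cis_iff[OF red(2)] angles by blast
  obtain t where t: "t \<noteq> 0" "of_int e = t * cos \<phi>" "of_int f = t * sin \<phi>"
    using cis(3) unfolding circle_point_eq_cis_iff[OF red(3)] angles by blast
  have "of_int ((a * d - c * b) * (c * f - e * d) * (a * f - e * b))
      = (r * s * sin (\<psi> - \<theta>)) * (s * t * sin (\<phi> - \<psi>)) * (r * t * sin (\<phi> - \<theta>))"
    by (simp only: of_int_mult of_int_diff r s t polar_det)
  also have "\<dots> = (r * s * t)\<^sup>2 * (sin (\<psi> - \<theta>) * sin (\<phi> - \<psi>) * sin (\<phi> - \<theta>))"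
    by (simp add: power2_eq_square)
  also have "\<dots> > 0"
    using r s t ord by (intro mult_pos_pos sin_gt_zero) (auto simp: angles)
  finally show ?thesis by (simp only: of_int_0_less_iff)
qed

lemma sin_pos_representative:
  assumes "sin (\<psi> - \<theta>) > 0"
  obtains \<psi>' where "cos \<psi>' = cos \<psi>" "sin \<psi>' = sin \<psi>" "\<theta> < \<psi>'" "\<psi>' < \<theta> + pi"
proof -
  obtain x where x: "- pi < x" "x \<le> pi" "sin x = sin (\<psi> - \<theta>)" "cos x = cos (\<psi> - \<theta>)"
    using sincos_principal_value[of "\<psi> - \<theta>"] by metis
  have "0 < x"
  proof (rule ccontr)
    assume "\<not> 0 < x"
    then have "sin (- x) \<ge> 0" using x by (intro sin_ge_zero) auto
    with x assms show False by simp
  qed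
  moreover have "x \<noteq> pi" using x assms by auto
  moreover have "cos (\<theta> + x) = cos (\<theta> + (\<psi> - \<theta>))" "sin (\<theta> + x) = sin (\<theta> + (\<psi> - \<theta>))"
    unfolding cos_add sin_add x by simp_all
  ultimately show ?thesis using that[of "\<theta> + x"] x by simp
qed

lemma reduced_rational_polar:
  assumes "reduced_rational a b v"
  obtains r \<theta> :: real where "r > 0" "of_int a = r * cos \<theta>" "of_int b = r * sin \<theta>"
proof -
  define z where "z = Complex (of_int a) (of_int b)"
  have "z \<noteq> 0" using assms by (auto simp: reduced_rational_def z_def complex_eq_iff)
  moreover have "z = rcis (cmod z) (Arg z)" by (simp add: rcis_cmod_Arg)
  then have "of_int a = cmod z * cos (Arg z)" "of_int b = cmod z * sin (Arg z)"
    by (simp_all add: complex_eq_iff z_def)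
  ultimately show ?thesis using that[of "cmod z" "Arg z"] by simp
qed

text \<open>Up to full turns, positive determinants put the polar angles in increasing order inside
  one half turn. Passing to the circle doubles the angles and reverses them, giving a clockwise
  triple within one full turn.\<close>

lemma clockwise_order_if_det:
  assumes red: "reduced_rational a b u" "reduced_rational c d v" "reduced_rational e f w"
    and det: "a * d - c * b > 0" "c * f - e * d > 0" "a * f - e * b > 0"
  shows "clockwise_order (circle_point (map_option of_rat u)) (circle_point (map_option of_rat v))
      (circle_point (map_option of_rat w))"
proof -
  obtain r \<theta> :: real where r: "r > 0" "of_int a = r * cos \<theta>" "of_int b = r * sin \<theta>"
    using reduced_rational_polar[OF red(1)] .
  obtain s \<psi> :: real where s: "s > 0" "of_int c = s * cos \<psi>" "of_int d = s * sin \<psi>"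
    using reduced_rational_polar[OF red(2)] .
  obtain t \<phi> :: real where t: "t > 0" "of_int e = t * cos \<phi>" "of_int f = t * sin \<phi>"
    using reduced_rational_polar[OF red(3)] .
  have "real_of_int (a * d - c * b) > 0" "real_of_int (c * f - e * d) > 0"
    "real_of_int (a * f - e * b) > 0"
    using det by (simp_all only: of_int_0_less_iff)
  then have "r * s * sin (\<psi> - \<theta>) > 0" "s * t * sin (\<phi> - \<psi>) > 0" "r * t * sin (\<phi> - \<theta>) > 0"
    by (simp_all only: of_int_mult of_int_diff r s t polar_det)
  moreover have "r * s > 0" "s * t > 0" "r * t > 0" using r(1) s(1) t(1) by simp_all
  ultimately have pos: "sin (\<psi> - \<theta>) > 0" "sin (\<phi> - \<psi>) > 0" "sin (\<phi> - \<theta>) > 0"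
    using zero_less_mult_pos by blast+
  \<comment> \<open>Both angles are moved into the half turn after \<open>\<theta>\<close>; the
    remaining determinant then orders them.\<close>
  obtain \<psi>' where \<psi>': "cos \<psi>' = cos \<psi>" "sin \<psi>' = sin \<psi>" "\<theta> < \<psi>'" "\<psi>' < \<theta> + pi"
    using sin_pos_representative[OF pos(1)] .
  obtain \<phi>' where \<phi>': "cos \<phi>' = cos \<phi>" "sin \<phi>' = sin \<phi>" "\<theta> < \<phi>'" "\<phi>' < \<theta> + pi"
    using sin_pos_representative[OF pos(3)] .
  have "\<psi>' < \<phi>'"
  proof (rule ccontr)
    assume "\<not> \<psi>' < \<phi>'"
    then have "sin (\<psi>' - \<phi>') \<ge> 0" using \<psi>' \<phi>' by (intro sin_ge_zero) auto
    moreover have "sin (\<psi>' - \<phi>') = - sin (\<phi> - \<psi>)" using \<psi>' \<phi>' by (simp add: sin_diff)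
    ultimately show False using pos by simp
  qed
  moreover have "circle_point (map_option of_rat u) = cis (pi / 2 - 2 * \<theta>)"
    unfolding circle_point_eq_cis_iff[OF red(1)] using r
    by (intro exI[of _ r]) (simp add: field_simps)
  moreover have "circle_point (map_option of_rat v) = cis (pi / 2 - 2 * \<psi>')"
    unfolding circle_point_eq_cis_iff[OF red(2)] using s \<psi>'
    by (intro exI[of _ s]) (simp add: field_simps)
  moreover have "circle_point (map_option of_rat w) = cis (pi / 2 - 2 * \<phi>')"
    unfolding circle_point_eq_cis_iff[OF red(3)] using t \<phi>'
    by (intro exI[of _ t]) (simp add: field_simps)
  ultimately show ?thesis
    unfolding clockwise_order_def using \<psi>' \<phi>'
    by (intro exI[of _ "pi / 2 - 2 * \<theta>"] exI[of _ "pi / 2 - 2 * \<psi>'"]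
          exI[of _ "pi / 2 - 2 * \<phi>'"]) auto
qed


section \<open>Normalised lifts\<close>

definition lift_tiling :: "(int \<Rightarrow> int) \<Rightarrow> (int \<Rightarrow> int) \<Rightarrow> tiling" where
  "lift_tiling a b = (\<lambda>i j. a j * b i - b j * a i)"

lemma normalised_lifts_det:
  "(a, b) \<in> normalised_lifts v \<Longrightarrow> a i * b (i + 1) - a (i + 1) * b i = 1"
  by (simp add: normalised_lifts_def)

lemma int_invariant_const:
  fixes f :: "int \<Rightarrow> 'a"
  assumes "\<And>i. f (i + 1) = f i"
  shows "f i = f j"
proof -
  have "f i = f 0" for i
  proof (induction i rule: int_induct[where k = 0])
    case (step2 i)
    then show ?case using assms[of "i - 1"] by simp
  qed (simp_all add: assms)
  then show ?thesis by metis
qed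

text \<open>Arbitrary representatives have consecutive determinants \<open>D i\<close> equal to 1 or
  -1; signs with \<open>s (i + 1) = s i * D i\<close> correct them all to 1.\<close>

lemma normalised_lifts_nonempty:
  assumes "\<And>i. farey_adjacent (v i) (v (i + 1))"
  obtains a b where "(a, b) \<in> normalised_lifts v"
proof -
  have "\<forall>i. \<exists>p q. reduced_rational p q (v i)" by (simp add: reduced_rational_exists)
  then obtain p q where red: "\<And>i. reduced_rational (p i) (q i) (v i)" by metis
  define D where "D i = p i * q (i + 1) - p (i + 1) * q i" for i
  have D: "D i = 1 \<or> D i = - 1" for i
    using farey_adjacent_reduced[OF assms red red, of i] by (auto simp: D_def algebra_simps)
  \<comment> \<open>One of the two intervals is always empty. For negative \<open>i\<close> the
    recursion would divide by \<open>D k\<close>, which for a sign is the same as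
    multiplying.\<close>
  define s where "s i = (\<Prod>k\<in>{0..<i} \<union> {i..<0}. D k)" for i
  have s: "s i = 1 \<or> s i = - 1" for i
  proof -
    have "\<bar>D k\<bar> = 1" for k using D[of k] by auto
    then have "\<bar>s i\<bar> = 1" unfolding s_def abs_prod by simp
    then show ?thesis by linarith
  qed
  have step: "s (i + 1) = s i * D i" for i
  proof (cases "i \<ge> 0")
    case True
    then have "{0..<i + 1} \<union> {i + 1..<0} = insert i ({0..<i} \<union> {i..<0})" by auto
    with True show ?thesis by (simp add: s_def)
  next
    case False
    then have "{0..<i} \<union> {i..<0} = insert i ({0..<i + 1} \<union> {i + 1..<0})" by auto
    with False have "s i = D i * s (i + 1)" by (simp add: s_def)
    with D[of i] show ?thesis by auto
  qed
  have "(s i * p i) * (s (i + 1) * q (i + 1)) - (s (i + 1) * p (i + 1)) * (s i * q i) = 1" for i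
  proof -
    have "(s i * p i) * (s (i + 1) * q (i + 1)) - (s (i + 1) * p (i + 1)) * (s i * q i)
        = s i * s (i + 1) * D i"
      by (simp add: D_def algebra_simps)
    also have "\<dots> = 1" using s[of i] D[of i] by (auto simp: step)
    finally show ?thesis .
  qed
  then have "(\<lambda>i. s i * p i, \<lambda>i. s i * q i) \<in> normalised_lifts v"
    using reduced_rational_sign[OF red s] by (simp add: normalised_lifts_def)
  then show ?thesis by (rule that)
qed

text \<open>The two lifts differ by a sign at each index, and the normalisation of both forces
  neighbouring signs to agree.\<close>

lemma normalised_lifts_unique:
  assumes ab: "(a, b) \<in> normalised_lifts v" and cd: "(c, d) \<in> normalised_lifts v"
  obtains s where "s = 1 \<or> s = - 1" "\<And>i. c i = s * a i" "\<And>i. d i = s * b i"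
proof -
  have det: "a i * b (i + 1) - a (i + 1) * b i = 1" "c i * d (i + 1) - c (i + 1) * d i = 1" for i
    using ab cd by (auto simp: normalised_lifts_def)
  have "\<exists>s. (s = 1 \<or> s = - 1) \<and> c i = s * a i \<and> d i = s * b i" for i
  proof -
    have "reduced_rational (a i) (b i) (v i)" "reduced_rational (c i) (d i) (v i)"
      using ab cd by (auto simp: normalised_lifts_def)
    then show ?thesis by (rule reduced_rational_unique) blast
  qed
  then obtain s where s: "\<And>i. s i = 1 \<or> s i = - 1" "\<And>i. c i = s i * a i" "\<And>i. d i = s i * b i"
    by metis
  have "s (i + 1) = s i" for i
  proof -
    have "s i * s (i + 1) * (a i * b (i + 1) - a (i + 1) * b i) = 1"
      using det(2)[of i] by (simp add: s(2,3) algebra_simps)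
    then have "s i * s (i + 1) = 1" unfolding det(1) by simp
    with s(1)[of i] show ?thesis by auto
  qed
  then have "s i = s 0" for i by (rule int_invariant_const)
  with s show ?thesis using that[of "s 0"] by metis
qed

lemma lift_tiling_unique:
  assumes "(a, b) \<in> normalised_lifts v" "(c, d) \<in> normalised_lifts v"
  shows "lift_tiling c d = lift_tiling a b"
proof -
  obtain s where "s = 1 \<or> s = - 1" "\<And>i. c i = s * a i" "\<And>i. d i = s * b i"
    using normalised_lifts_unique[OF assms] by blast
  then show ?thesis by (auto simp: lift_tiling_def)
qed

text \<open>A linear map multiplies all determinants of pairs of vectors by its own determinant,
  here 1.\<close>

lemma normalised_lifts_moebius:
  assumes A: "A \<in> SL2Z" and ab: "(a, b) \<in> normalised_lifts v"
  defines "c \<equiv> \<lambda>i. A$1$1 * a i + A$1$2 * b i" and "d \<equiv> \<lambda>i. A$2$1 * a i + A$2$2 * b i"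
  shows "(c, d) \<in> normalised_lifts (\<lambda>i. moebius A (v i))" "lift_tiling c d = lift_tiling a b"
proof -
  have det: "A$1$1 * A$2$2 - A$1$2 * A$2$1 = 1"
    using A by (simp add: SL2Z_def det_2)
  have minor: "c j * d i - d j * c i = a j * b i - b j * a i" for i j
  proof -
    have "c j * d i - d j * c i = (A$1$1 * A$2$2 - A$1$2 * A$2$1) * (a j * b i - b j * a i)"
      by (simp add: c_def d_def algebra_simps)
    then show ?thesis unfolding det by simp
  qed
  then show "lift_tiling c d = lift_tiling a b" by (simp add: lift_tiling_def)
  have "c i * d (i + 1) - c (i + 1) * d i = 1" for i
  proof -
    have "a i * b (i + 1) - a (i + 1) * b i = 1" using ab by (simp add: normalised_lifts_def)
    with minor[of i "i + 1"] show ?thesis by (simp add: mult.commute)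
  qed
  then show "(c, d) \<in> normalised_lifts (\<lambda>i. moebius A (v i))"
    using ab moebius_reduced[OF A] by (simp add: normalised_lifts_def c_def d_def)
qed

text \<open>All vectors \<open>(a i, b i)\<close> are combinations of those at \<open>0\<close> and \<open>1\<close>, with coefficients
  that are entries of the tiling.\<close>

lemma moebius_if_lift_tiling_eq:
  assumes ab: "(a, b) \<in> normalised_lifts v" and cd: "(c, d) \<in> normalised_lifts w"
    and eq: "lift_tiling a b = lift_tiling c d"
  obtains A where "A \<in> SL2Z" "\<And>i. w i = moebius A (v i)"
proof -
  \<comment> \<open>This is the matrix with columns \<open>(c 0, d 0)\<close> and
    \<open>(c 1, d 1)\<close> times the inverse of the one with columns \<open>(a 0, b 0)\<close>
    and \<open>(a 1, b 1)\<close>.\<close>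
  define A :: "int^2^2" where
    "A = vector [vector [c 0 * b 1 - c 1 * b 0, c 1 * a 0 - c 0 * a 1],
                 vector [d 0 * b 1 - d 1 * b 0, d 1 * a 0 - d 0 * a 1]]"
  have det: "a 0 * b 1 - a 1 * b 0 = 1" "c 0 * d 1 - c 1 * d 0 = 1"
    using normalised_lifts_det[OF ab, of 0] normalised_lifts_det[OF cd, of 0] by simp_all
  have "det A = (a 0 * b 1 - a 1 * b 0) * (c 0 * d 1 - c 1 * d 0)"
    by (simp add: A_def det_2 algebra_simps)
  then have A: "A \<in> SL2Z" by (simp add: det SL2Z_def)
  have minor: "a j * b i - b j * a i = c j * d i - d j * c i" for i j
    using eq by (simp add: lift_tiling_def fun_eq_iff)
  have c: "c i = A$1$1 * a i + A$1$2 * b i" for i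
  proof -
    have "A$1$1 * a i + A$1$2 * b i
        = c 1 * (a 0 * b i - b 0 * a i) - c 0 * (a 1 * b i - b 1 * a i)"
      by (simp add: A_def algebra_simps)
    also have "\<dots> = (c 0 * d 1 - c 1 * d 0) * c i"
      unfolding minor by (simp add: algebra_simps)
    finally show ?thesis by (simp add: det)
  qed
  have d: "d i = A$2$1 * a i + A$2$2 * b i" for i
  proof -
    have "A$2$1 * a i + A$2$2 * b i
        = d 1 * (a 0 * b i - b 0 * a i) - d 0 * (a 1 * b i - b 1 * a i)"
      by (simp add: A_def algebra_simps)
    also have "\<dots> = (c 0 * d 1 - c 1 * d 0) * d i"
      unfolding minor by (simp add: algebra_simps)
    finally show ?thesis by (simp add: det)
  qed
  have "w i = moebius A (v i)" for i
  proof (rule reduced_rational_fun)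
    show "reduced_rational (c i) (d i) (w i)" using cd by (simp add: normalised_lifts_def)
    show "reduced_rational (c i) (d i) (moebius A (v i))"
      unfolding c d using ab by (intro moebius_reduced A) (simp add: normalised_lifts_def)
  qed
  with A show ?thesis by (rule that)
qed


section \<open>Periodic extensions\<close>

lemma bi_infinite_map:
  assumes "length vs = n + 1" "n > 0"
  shows "bi_infinite n (map f vs) i = f (bi_infinite n vs i)"
proof -
  have "i mod int n < int (length vs)"
    using assms pos_mod_bound[of "int n" i] by linarith
  then show ?thesis
    using assms(2) by (simp add: bi_infinite_def nat_less_iff)
qed

lemma bi_infinite_adjacent:
  assumes "n > 0" "farey_closed_path n vs"
  shows "farey_adjacent (bi_infinite n vs i) (bi_infinite n vs (i + 1))"
proof -
  define k where "k = nat (i mod int n)"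
  have k: "i mod int n = int k" "k < n"
    using \<open>n > 0\<close> by (simp_all add: k_def nat_less_iff)
  have "bi_infinite n vs (i + 1) = vs ! (k + 1)"
  \<comment> \<open>At the wrap-around the next index reduces to 0, and
    \<open>vs ! 0 = vs ! n\<close> closes the gap.\<close>
  proof (cases "k + 1 = n")
    case True
    then have "(i + 1) mod int n = 0" using k by (metis mod_add_left_eq mod_self of_nat_1 of_nat_add)
    with True assms show ?thesis by (simp add: bi_infinite_def farey_closed_path_def)
  next
    case False
    have "(i + 1) mod int n = (int k + 1) mod int n" using k by (metis mod_add_left_eq)
    also have "\<dots> = int (k + 1)" using False k by simp
    finally show ?thesis by (simp add: bi_infinite_def nat_add_distrib)
  qed
  with assms k show ?thesis by (simp add: bi_infinite_def farey_closed_path_def)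
qed

lemma bi_infinite_nth:
  assumes "farey_closed_path n vs" "k \<le> n"
  shows "bi_infinite n vs (int k) = vs ! k"
  using assms by (cases "k = n") (simp_all add: bi_infinite_def farey_closed_path_def)

text \<open>The union collapses to one pair of tilings: lifts of one path differ by a global sign,
  and moving the path by \<open>SL2Z\<close> keeps all determinants. The given lift ensures that the
  union is not empty.\<close>

lemma Phi_orbit:
  assumes len: "length vs = n + 1" "n > 0" and ab: "(a, b) \<in> normalised_lifts (bi_infinite n vs)"
  shows "\<Phi> n (SL2Z_orbit vs) = up_to_sign (lift_tiling a b)"
proof -
  have eq: "lift_tiling c d = lift_tiling a b"
    if us: "us \<in> SL2Z_orbit vs" and cd: "(c, d) \<in> normalised_lifts (bi_infinite n us)" for us c d
  proof -
    obtain A where A: "A \<in> SL2Z" "us = map (moebius A) vs"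
      using us by (auto simp: SL2Z_orbit_def)
    have "bi_infinite n us = (\<lambda>i. moebius A (bi_infinite n vs i))"
      using len A(2) by (simp add: bi_infinite_map fun_eq_iff)
    then have "(c, d) \<in> normalised_lifts (\<lambda>i. moebius A (bi_infinite n vs i))"
      using cd by simp
    from lift_tiling_unique[OF normalised_lifts_moebius(1)[OF A(1) ab] this]
    show ?thesis unfolding normalised_lifts_moebius(2)[OF A(1) ab] .
  qed
  have \<Phi>: "\<Phi> n (SL2Z_orbit vs) = (\<Union>us\<in>SL2Z_orbit vs.
      \<Union>(c, d)\<in>normalised_lifts (bi_infinite n us). up_to_sign (lift_tiling c d))"
    by (simp add: \<Phi>_def lift_tiling_def)
  show ?thesis
    unfolding \<Phi>
  proof
    show "(\<Union>us\<in>SL2Z_orbit vs. \<Union>(c, d)\<in>normalised_lifts (bi_infinite n us).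
        up_to_sign (lift_tiling c d)) \<subseteq> up_to_sign (lift_tiling a b)"
      by (auto dest: eq)
    show "up_to_sign (lift_tiling a b) \<subseteq> (\<Union>us\<in>SL2Z_orbit vs.
        \<Union>(c, d)\<in>normalised_lifts (bi_infinite n us). up_to_sign (lift_tiling c d))"
      using self_in_SL2Z_orbit ab by blast
  qed
qed

lemma closed_path_normalised_lift:
  assumes "n > 0" "vs \<in> C_plus n"
  obtains a b where "(a, b) \<in> normalised_lifts (bi_infinite n vs)"
proof -
  have "farey_closed_path n vs" using assms(2) by (simp add: C_plus_def simple_closed_path_def)
  then show ?thesis
    using normalised_lifts_nonempty[of "bi_infinite n vs"] bi_infinite_adjacent[OF assms(1)] that
    by blast
qed

lemma in_SL2Z_orbit_if_lift_tiling_eq: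
  assumes vs: "farey_closed_path n vs" "(a, b) \<in> normalised_lifts (bi_infinite n vs)"
    and us: "farey_closed_path n us" "(c, d) \<in> normalised_lifts (bi_infinite n us)"
    and eq: "lift_tiling a b = lift_tiling c d"
  shows "us \<in> SL2Z_orbit vs"
proof -
  obtain A where A: "A \<in> SL2Z" "\<And>i. bi_infinite n us i = moebius A (bi_infinite n vs i)"
    using moebius_if_lift_tiling_eq[OF vs(2) us(2) eq] by blast
  have "us = map (moebius A) vs"
  proof (rule nth_equalityI)
    show "length us = length (map (moebius A) vs)"
      using vs us by (simp add: farey_closed_path_def)
    fix k assume "k < length us"
    then have "k \<le> n" "k < length vs" using vs us by (simp_all add: farey_closed_path_def)
    then show "us ! k = map (moebius A) vs ! k"
      using A(2)[of "int k"] vs us by (simp add: bi_infinite_nth)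
  qed
  with A(1) show ?thesis by (auto simp: SL2Z_orbit_def)
qed


section \<open>From paths to friezes\<close>

text \<open>The tiling is a product of matrices of inner size two, so its adjacent minors are
  products of two consecutive determinants.\<close>

lemma SL2_tiling_lift_tiling:
  assumes "(a, b) \<in> normalised_lifts v"
  shows "SL2_tiling (lift_tiling a b)"
  unfolding SL2_tiling_def
proof (intro allI)
  fix i j
  have det: "a i * b (i + 1) - a (i + 1) * b i = 1" for i
    using assms by (simp add: normalised_lifts_def)
  have "lift_tiling a b i j * lift_tiling a b (i + 1) (j + 1)
        - lift_tiling a b i (j + 1) * lift_tiling a b (i + 1) j
      = (a i * b (i + 1) - a (i + 1) * b i) * (a j * b (j + 1) - a (j + 1) * b j)"
    by (simp add: lift_tiling_def algebra_simps)
  then show "lift_tiling a b i j * lift_tiling a b (i + 1) (j + 1)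
      - lift_tiling a b i (j + 1) * lift_tiling a b (i + 1) j = 1"
    by (simp add: det)
qed

text \<open>Every row is a combination of the sequences \<open>a\<close> and \<open>b\<close>, so
  the rank is at most two.\<close>

lemma tame_lift_tiling: "tame (lift_tiling a b)"
  by (simp add: tame_def lift_tiling_def det_3 algebra_simps)

lemma positive_frieze_lift_tiling:
  assumes n: "n > 1" and vs: "vs \<in> C_plus n" and ab: "(a, b) \<in> normalised_lifts (bi_infinite n vs)"
  shows "positive_frieze n (lift_tiling a b)"
proof -
  define M where "M = lift_tiling a b"
  have path: "farey_closed_path n vs" and cw: "clockwise_path n vs"
    using vs by (auto simp: C_plus_def simple_closed_path_def)
  have red: "reduced_rational (a i) (b i) (bi_infinite n vs i)"
    and det: "a i * b (i + 1) - a (i + 1) * b i = 1" for i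
    using ab by (auto simp: normalised_lifts_def)
  have M_Suc: "M (i + 1) i = 1" for i
    using det[of i] by (simp add: M_def lift_tiling_def algebra_simps)
  have M_pos_window: "j < i \<Longrightarrow> i < n \<Longrightarrow> M (int i) (int j) > 0" for i j :: nat
  proof (induction i)
    case (Suc i)
    show ?case
    proof (cases "j = i")
      case True
      then show ?thesis using M_Suc[of "int i"] by (simp add: add.commute)
    next
      case False
      with Suc have "j < i" and IH: "M (int i) (int j) > 0" by auto
      have r: "reduced_rational (a (int k)) (b (int k)) (vs ! k)" if "k \<le> n" for k
        using red[of "int k"] that path by (simp add: bi_infinite_nth)
      have "clockwise_order (circle_point (map_option of_rat (vs ! j)))
        (circle_point (map_option of_rat (vs ! i))) (circle_point (map_option of_rat (vs ! Suc i)))"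
        using cw \<open>j < i\<close> \<open>Suc i < n\<close> by (simp add: clockwise_path_def)
      \<comment> \<open>The first factor is positive by induction and the second is 1, so the sign
        of the third is determined.\<close>
      then have "M (int i) (int j) * M (int (Suc i)) (int i) * M (int (Suc i)) (int j) > 0"
        using clockwise_order_imp_det[OF r r r, of j i "Suc i"] \<open>j < i\<close> \<open>Suc i < n\<close>
        by (simp add: M_def lift_tiling_def algebra_simps)
      with IH M_Suc[of "int i"] show ?thesis
        by (simp add: zero_less_mult_iff add.commute)
    qed
  qed simp
  have "(\<lambda>i. a (i + int n), \<lambda>i. b (i + int n)) \<in> normalised_lifts (bi_infinite n vs)"
  proof -
    have "bi_infinite n vs (i + int n) = bi_infinite n vs i" for i
      by (simp add: bi_infinite_def)
    then show ?thesis
      using red[of "i + int n" for i] det[of "i + int n" for i]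
      by (simp add: normalised_lifts_def add.commute add.left_commute)
  qed
  then obtain s where s: "s = 1 \<or> s = - 1" "\<And>i. a (i + int n) = s * a i" "\<And>i. b (i + int n) = s * b i"
    using normalised_lifts_unique[OF ab] by blast
  have M_shift: "M (i + int n) j = s * M i j" for i j
    by (simp add: M_def lift_tiling_def s algebra_simps)
  have antisym: "M j i = - M i j" for i j
    by (simp add: M_def lift_tiling_def algebra_simps)
  have "s = - 1"
  proof -
    have "s * M 0 (int n - 1) = 1"
      using M_Suc[of "int n - 1"] M_shift[of 0 "int n - 1"] by simp
    moreover have "M 0 (int n - 1) < 0"
      using M_pos_window[of 0 "n - 1"] antisym[of 0 "int n - 1"] n by (simp add: of_nat_diff)
    ultimately show ?thesis using s(1) by auto
  qed
  have M_shift_both: "M (i + int n) (j + int n) = M i j" for i j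
    using s by (auto simp: M_def lift_tiling_def)
  have M_pos: "M i j > 0" if ij: "0 \<le> j" "j < int n" "0 < i - j" "i - j < int n" for i j
  proof (cases "i < int n")
    case True
    then show ?thesis using M_pos_window[of "nat j" "nat i"] ij by (simp add: nat_less_iff)
  next
    case False
    \<comment> \<open>The index \<open>i - int n\<close> falls below \<open>j\<close> within the
      window; the sign from the shift and the sign from antisymmetry cancel.\<close>
    then have "M j (i - int n) > 0"
      using M_pos_window[of "nat (i - int n)" "nat j"] ij by (simp add: nat_less_iff)
    then show ?thesis
      using M_shift[of "i - int n" j] antisym[of "i - int n" j] \<open>s = - 1\<close> by simp
  qed
  have M_shift_mult: "M (i + k * int n) (j + k * int n) = M i j" for i j k
  proof -
    have "M (i + k * int n) (j + k * int n) = M (i + 0 * int n) (j + 0 * int n)"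
      by (rule int_invariant_const[of "\<lambda>k. M (i + k * int n) (j + k * int n)"])
        (simp add: M_shift_both distrib_right flip: add.assoc)
    then show ?thesis by simp
  qed
  have "M i j > 0" if "0 < i - j" "i - j < int n" for i j
  proof -
    \<comment> \<open>Shifting both indices by a multiple of the period changes no entry, since the
      sign occurs twice; this brings \<open>j\<close> into the window.\<close>
    define k where "k = j div int n"
    have j: "j = j mod int n + k * int n" by (simp add: k_def)
    have "M (i - k * int n) (j mod int n) > 0"
      using that n j by (intro M_pos) auto
    then show ?thesis
      using M_shift_mult[of "i - k * int n" k "j mod int n"] j by simp
  qed
  moreover have "M i i = 0" for i by (simp add: M_def lift_tiling_def)
  moreover from this have "M (i + int n) i = 0" for i by (simp add: M_shift)
  ultimately show ?thesis
    unfolding positive_frieze_def tame_frieze_def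
    using SL2_tiling_lift_tiling[OF ab] tame_lift_tiling[of a b] by (simp add: M_def)
qed


section \<open>From friezes to paths\<close>

text \<open>The vector \<open>(1, - d, 1)\<close> is the cross product of two consecutive rows of a strip of three
  columns. Tameness makes it orthogonal to the next row as well.\<close>

lemma tame_column_recurrence:
  assumes "SL2_tiling M" "tame M"
  obtains d where "\<And>i j. M i (j + 2) = d j * M i (j + 1) - M i j"
proof -
  \<comment> \<open>The minor on the outer two columns is the candidate coefficient; the other two
    minors of adjacent rows are 1. The identities \<open>row\<close> and \<open>row'\<close> expand
    determinants with a repeated row.\<close>
  define D where "D j i = M i j * M (i + 1) (j + 2) - M i (j + 2) * M (i + 1) j" for i j
  have sl: "M i j * M (i + 1) (j + 1) - M i (j + 1) * M (i + 1) j = 1"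
    "M i (j + 1) * M (i + 1) (j + 2) - M i (j + 2) * M (i + 1) (j + 1) = 1" for i j
    using assms(1)[unfolded SL2_tiling_def, rule_format, of i j]
      assms(1)[unfolded SL2_tiling_def, rule_format, of i "j + 1"]
    by (simp_all add: add.assoc)
  have row: "M i (j + 2) = D j i * M i (j + 1) - M i j" for i j
  proof -
    have "D j i * M i (j + 1)
        = M i j * (M i (j + 1) * M (i + 1) (j + 2) - M i (j + 2) * M (i + 1) (j + 1))
          + M i (j + 2) * (M i j * M (i + 1) (j + 1) - M i (j + 1) * M (i + 1) j)"
      by (simp add: D_def algebra_simps)
    then show ?thesis by (simp add: sl)
  qed
  have row': "M (i + 1) (j + 2) = D j i * M (i + 1) (j + 1) - M (i + 1) j" for i j
  proof -
    have "D j i * M (i + 1) (j + 1)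
        = M (i + 1) j * (M i (j + 1) * M (i + 1) (j + 2) - M i (j + 2) * M (i + 1) (j + 1))
          + M (i + 1) (j + 2) * (M i j * M (i + 1) (j + 1) - M i (j + 1) * M (i + 1) j)"
      by (simp add: D_def algebra_simps)
    then show ?thesis by (simp add: sl)
  qed
  have row'': "M (i + 2) (j + 2) = D j i * M (i + 2) (j + 1) - M (i + 2) j" for i j
  proof -
    have "0 = M (i + 2) j * (M i (j + 1) * M (i + 1) (j + 2) - M i (j + 2) * M (i + 1) (j + 1))
        - M (i + 2) (j + 1) * D j i
        + M (i + 2) (j + 2) * (M i j * M (i + 1) (j + 1) - M i (j + 1) * M (i + 1) j)"
      using assms(2)[unfolded tame_def, rule_format, of i j]
      by (simp add: det_3 D_def algebra_simps)
    then show ?thesis unfolding sl by (simp add: mult.commute)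
  qed
  \<comment> \<open>The strips starting in rows \<open>i\<close> and \<open>i + 1\<close> share two
    rows. Their middle entries belong to a minor equal to 1, so they are not both zero and the
    coefficients agree.\<close>
  have D_Suc: "D j (i + 1) = D j i" for i j
  proof -
    have "D j i * M (i + 1) (j + 1) = D j (i + 1) * M (i + 1) (j + 1)"
      "D j i * M (i + 2) (j + 1) = D j (i + 1) * M (i + 2) (j + 1)"
      using row'[of i j] row[of "i + 1" j] row''[of i j] row'[of "i + 1" j]
      unfolding add.assoc one_add_one by linarith+
    moreover have "M (i + 1) (j + 1) \<noteq> 0 \<or> M (i + 2) (j + 1) \<noteq> 0"
      using sl(1)[of "i + 1" j] by (auto simp: add.assoc)
    ultimately show ?thesis by auto
  qed
  have "D j i = D j 0" for i j by (rule int_invariant_const) (rule D_Suc)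
  with row show ?thesis using that[of "\<lambda>j. D j 0"] by metis
qed

text \<open>Fits a second-order recurrence that can be run in both directions.\<close>

lemma int_two_step_induct:
  fixes P :: "int \<Rightarrow> bool"
  assumes "P 0" "P 1" "\<And>j. P j \<Longrightarrow> P (j + 1) \<Longrightarrow> P (j + 2)" "\<And>j. P (j + 1) \<Longrightarrow> P (j + 2) \<Longrightarrow> P j"
  shows "P j"
proof -
  have "P j \<and> P (j + 1)"
  proof (induction j rule: int_induct[where k = 0])
    case base
    show ?case using assms by simp
  next
    case (step1 i)
    then show ?case using assms(3)[of i] by (simp add: add.assoc)
  next
    case (step2 i)
    then show ?case using assms(4)[of "i - 1"] by (simp add: algebra_simps)
  qed
  then show ?thesis ..
qed

text \<open>The recurrence writes column \<open>j\<close> through columns 0 and 1; the zero diagonal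
  and the subdiagonal of ones then express the coefficients by row \<open>j\<close>.\<close>

lemma tame_eq_lift_tiling:
  assumes M: "SL2_tiling M" "tame M" and diag: "\<And>i. M i i = 0" and sub: "\<And>i. M (i + 1) i = 1"
  shows "M = lift_tiling (\<lambda>i. M i 0) (\<lambda>i. M i 1)"
proof -
  have sl: "M i j * M (i + 1) (j + 1) - M i (j + 1) * M (i + 1) j = 1" for i j
    using M(1) by (simp add: SL2_tiling_def)
  have sup: "M i (i + 1) = - 1" for i
    using sl[of i i] by (simp add: diag sub)
  obtain d where d: "\<And>i j. M i (j + 2) = d j * M i (j + 1) - M i j"
    using tame_column_recurrence[OF M] by blast
  \<comment> \<open>The coefficients are found from rows 0 and 1, where columns 0 and 1 have the
    entries 0, 1 and -1, 0.\<close>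
  have span: "\<forall>i. M i j = M 1 j * M i 0 - M 0 j * M i 1" for j
  proof (induction j rule: int_two_step_induct)
    case 1
    show ?case using sub[of 0] diag[of 0] by simp
  next
    case 2
    show ?case using sup[of 0] diag[of 1] by simp
  next
    case (3 j)
    show ?case
    proof
      fix i
      have "M i (j + 2) = d j * (M 1 (j + 1) * M i 0 - M 0 (j + 1) * M i 1)
          - (M 1 j * M i 0 - M 0 j * M i 1)"
        using d[of i j] 3 by metis
      then show "M i (j + 2) = M 1 (j + 2) * M i 0 - M 0 (j + 2) * M i 1"
        unfolding d[of 0] d[of 1] by (simp add: algebra_simps)
    qed
  next
    case (4 j)
    show ?case
    proof
      fix i
      have d': "M i j = d j * M i (j + 1) - M i (j + 2)" for i using d[of i j] by simp
      have "M i j = d j * (M 1 (j + 1) * M i 0 - M 0 (j + 1) * M i 1)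
          - (M 1 (j + 2) * M i 0 - M 0 (j + 2) * M i 1)"
        using d'[of i] 4 by metis
      then show "M i j = M 1 j * M i 0 - M 0 j * M i 1"
        unfolding d'[of 0] d'[of 1] by (simp add: algebra_simps)
    qed
  qed
  have w: "M j 0 * M (j + 1) 1 - M j 1 * M (j + 1) 0 = 1" for j
    using sl[of j 0] by simp
  text \<open>The functional \<open>(x, y) \<mapsto> M 1 j * x - M 0 j * y\<close> and the minor with \<open>(M j 0, M j 1)\<close> agree
    at \<open>(M j 0, M j 1)\<close> and at \<open>(M (j + 1) 0, M (j + 1) 1)\<close>, hence everywhere.\<close>
  have "M 1 j = - M j 1" "M 0 j = - M j 0" for j
  proof -
    have e: "M 1 j * M j 0 = M 0 j * M j 1" "M 1 j * M (j + 1) 0 - M 0 j * M (j + 1) 1 = 1"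
      using span[of j] diag[of j] sub[of j] by (metis eq_iff_diff_eq_0, metis)
    have "M 1 j = M 1 j * (M j 0 * M (j + 1) 1 - M j 1 * M (j + 1) 0)" by (simp add: w)
    also have "\<dots> = (M 1 j * M j 0) * M (j + 1) 1 - M j 1 * (M 1 j * M (j + 1) 0)"
      by (simp add: algebra_simps)
    also have "\<dots> = - M j 1 * (M 1 j * M (j + 1) 0 - M 0 j * M (j + 1) 1)"
      unfolding e(1) by (simp add: algebra_simps)
    finally show "M 1 j = - M j 1" by (simp add: e(2))
    have "M 0 j = M 0 j * (M j 0 * M (j + 1) 1 - M j 1 * M (j + 1) 0)" by (simp add: w)
    also have "\<dots> = M j 0 * (M 0 j * M (j + 1) 1) - (M 0 j * M j 1) * M (j + 1) 0"
      by (simp add: algebra_simps)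
    also have "\<dots> = - M j 0 * (M 1 j * M (j + 1) 0 - M 0 j * M (j + 1) 1)"
      unfolding e(1)[symmetric] by (simp add: algebra_simps)
    finally show "M 0 j = - M j 0" by (simp add: e(2))
  qed
  with span show ?thesis
    unfolding lift_tiling_def fun_eq_iff by (metis diff_minus_eq_add minus_mult_left uminus_add_conv_diff)
qed

lemma positive_frieze_path:
  assumes n: "n > 1" and M: "positive_frieze n M"
  obtains vs a b where "vs \<in> C_plus n" "(a, b) \<in> normalised_lifts (bi_infinite n vs)"
    "M = lift_tiling a b"
proof -
  have sl: "SL2_tiling M" and diag: "M i i = 0" "M (i + int n) i = 0"
    and pos: "0 < i - j \<Longrightarrow> i - j < int n \<Longrightarrow> 0 < M i j" and "tame M" for i j
    using M by (auto simp: positive_frieze_def tame_frieze_def)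
  \<comment> \<open>The diagonal vanishes, so the entry is a unit; as \<open>n > 1\<close>, it lies
    in the positive strip.\<close>
  have sub: "M (i + 1) i = 1" for i
  proof -
    have "M i (i + 1) * M (i + 1) i = - 1"
      using sl[unfolded SL2_tiling_def, rule_format, of i i] diag by simp
    moreover have "M (i + 1) i > 0" using pos[of "i + 1" i] n by simp
    ultimately show ?thesis
      by (metis dvd_minus_iff dvd_triv_right zdvd1_eq abs_of_pos)
  qed
  define a b where "a = (\<lambda>i. M i 0)" and "b = (\<lambda>i. M i 1)"
  have M_eq: "M = lift_tiling a b"
    unfolding a_def b_def using sl \<open>tame M\<close> diag sub by (intro tame_eq_lift_tiling)
  have M_apply: "M i j = a j * b i - b j * a i" for i j
    by (subst M_eq) (simp add: lift_tiling_def)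
  have det: "a i * b (i + 1) - a (i + 1) * b i = 1" for i
    using sub[of i] by (simp add: M_apply algebra_simps)
  define v where "v i = (if b i = 0 then None else Some (of_int (a i) / of_int (b i) :: rat))" for i
  have red: "reduced_rational (a i) (b i) (v i)" for i
    using coprime_if_det_1[OF det] by (simp add: reduced_rational_def v_def)
  have v_period: "v (i + int n) = v i" for i
  proof -
    \<comment> \<open>The zero entry \<open>M (i + int n) i\<close> makes the vectors at
      \<open>i\<close> and \<open>i + int n\<close> proportional, so they represent one
      vertex.\<close>
    have "a i * b (i + int n) = b i * a (i + int n)"
      using diag(2)[of i] by (simp add: M_apply)
    then obtain s where s: "s = 1 \<or> s = - 1" "a (i + int n) = s * a i" "b (i + int n) = s * b i"
      using coprime_proportional[OF coprime_if_det_1[OF det] coprime_if_det_1[OF det]]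
      by metis
    show ?thesis
      by (rule reduced_rational_fun[OF red]) (use s red reduced_rational_sign in metis)
  qed
  have v_mod: "v (i mod int n) = v i" for i
  proof -
    have "v (i mod int n + (i div int n) * int n) = v (i mod int n + 0 * int n)"
      by (rule int_invariant_const[of "\<lambda>k. v (i mod int n + k * int n)"])
        (simp add: v_period distrib_right flip: add.assoc)
    then show ?thesis by simp
  qed
  define vs where "vs = map (\<lambda>k. v (int k)) [0..<n + 1]"
  have vs_nth: "vs ! k = v (int k)" if "k \<le> n" for k
    using that by (simp add: vs_def nth_append del: upt_Suc)
  have bi: "bi_infinite n vs = v"
  proof
    fix i
    have "nat (i mod int n) \<le> n" using n by (simp add: nat_le_iff order_less_imp_le)
    then show "bi_infinite n vs i = v i"
      using n by (simp add: bi_infinite_def vs_nth v_mod)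
  qed
  have lift: "(a, b) \<in> normalised_lifts (bi_infinite n vs)"
    using red det by (simp add: bi normalised_lifts_def)
  have "farey_adjacent (v i) (v (1 + i))" for i
    unfolding farey_adjacent_def using red det by (metis abs_1 mult.commute add.commute)
  then have path: "farey_closed_path n vs"
    using v_period[of 0] n
    by (simp add: farey_closed_path_def vs_nth) (simp add: vs_def add.commute)
  \<comment> \<open>A repeated vertex would give a zero entry inside the positive strip.\<close>
  have "v (int i) \<noteq> v (int j)" if "j < i" "i < n" for i j
  proof
    assume "v (int i) = v (int j)"
    then obtain s where "a (int i) = s * a (int j)" "b (int i) = s * b (int j)"
      using reduced_rational_unique red by metis
    then have "M (int i) (int j) = 0" by (simp add: M_apply)
    with pos[of "int i" "int j"] that show False by simp
  qed
  then have "distinct (take n vs)"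
    by (auto simp: distinct_conv_nth vs_nth) (metis linorder_neqE_nat)
  moreover have "clockwise_path n vs"
    unfolding clockwise_path_def
  proof (intro allI impI)
    fix i j k assume ijk: "i < j \<and> j < k \<and> k < n"
    have "M (int j) (int i) > 0" "M (int k) (int j) > 0" "M (int k) (int i) > 0"
      using ijk by (intro pos; simp)+
    then show "clockwise_order (circle_point (map_option of_rat (vs ! i)))
        (circle_point (map_option of_rat (vs ! j))) (circle_point (map_option of_rat (vs ! k)))"
      using ijk clockwise_order_if_det[OF red red red] by (simp add: vs_nth M_apply mult.commute)
  qed
  ultimately have "vs \<in> C_plus n" using path by (simp add: C_plus_def simple_closed_path_def)
  then show ?thesis using that lift M_eq by blast
qed

section \<open>Injectivity and surjectivity on orbits\<close>

theorem theorem1p7: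
  fixes n :: nat
  assumes "n > 1"
  shows "bij_betw (\<Phi> n) (C_plus_mod_SL2Z n) (FR_plus n)"
proof (rule bij_betw_imageI)
  have n: "n > 0" using assms by simp
  have closed: "farey_closed_path n vs" "length vs = n + 1" if "vs \<in> C_plus n" for vs
    using that by (auto simp: C_plus_def simple_closed_path_def farey_closed_path_def)
  show "inj_on (\<Phi> n) (C_plus_mod_SL2Z n)"
  proof (rule inj_onI)
    fix X Y assume XY: "X \<in> C_plus_mod_SL2Z n" "Y \<in> C_plus_mod_SL2Z n" "\<Phi> n X = \<Phi> n Y"
    obtain vs where vs: "vs \<in> C_plus n" "X = SL2Z_orbit vs"
      using XY(1) by (auto simp: C_plus_mod_SL2Z_def)
    obtain us where us: "us \<in> C_plus n" "Y = SL2Z_orbit us"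
      using XY(2) by (auto simp: C_plus_mod_SL2Z_def)
    obtain a b where ab: "(a, b) \<in> normalised_lifts (bi_infinite n vs)"
      using closed_path_normalised_lift[OF n vs(1)] .
    obtain c d where cd: "(c, d) \<in> normalised_lifts (bi_infinite n us)"
      using closed_path_normalised_lift[OF n us(1)] .
    have "up_to_sign (lift_tiling a b) = up_to_sign (lift_tiling c d)"
      using XY(3) Phi_orbit[OF closed(2) n ab] Phi_orbit[OF closed(2) n cd] vs us by simp
    then have "lift_tiling a b = lift_tiling c d \<or> lift_tiling a b = (\<lambda>i j. - lift_tiling c d i j)"
      by (auto simp: up_to_sign_def doubleton_eq_iff)
    \<comment> \<open>Normalisation fixes this entry for both lifts, which excludes the opposite
      sign.\<close>
    moreover have "lift_tiling a b 1 0 = 1" "lift_tiling c d 1 0 = 1"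
      using normalised_lifts_det[OF ab, of 0] normalised_lifts_det[OF cd, of 0]
      by (simp_all add: lift_tiling_def mult.commute)
    ultimately have eq: "lift_tiling a b = lift_tiling c d" by (auto simp: fun_eq_iff)
    have "us \<in> X" "vs \<in> Y"
      using in_SL2Z_orbit_if_lift_tiling_eq closed ab cd eq vs us by metis+
    then show "X = Y"
      unfolding vs us using SL2Z_orbit_subset by blast
  qed
  show "\<Phi> n ` C_plus_mod_SL2Z n = FR_plus n"
  proof
    show "\<Phi> n ` C_plus_mod_SL2Z n \<subseteq> FR_plus n"
    proof
      fix F assume "F \<in> \<Phi> n ` C_plus_mod_SL2Z n"
      then obtain vs where vs: "vs \<in> C_plus n" "F = \<Phi> n (SL2Z_orbit vs)"
        by (auto simp: C_plus_mod_SL2Z_def)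
      obtain a b where ab: "(a, b) \<in> normalised_lifts (bi_infinite n vs)"
        using closed_path_normalised_lift[OF n vs(1)] .
      show "F \<in> FR_plus n"
        using Phi_orbit[OF closed(2) n ab] positive_frieze_lift_tiling[OF assms vs(1) ab] vs
        by (auto simp: FR_plus_def)
    qed
    show "FR_plus n \<subseteq> \<Phi> n ` C_plus_mod_SL2Z n"
    proof
      fix F assume "F \<in> FR_plus n"
      then obtain M where M: "positive_frieze n M" "F = up_to_sign M"
        by (auto simp: FR_plus_def)
      obtain vs a b where vs: "vs \<in> C_plus n" "(a, b) \<in> normalised_lifts (bi_infinite n vs)"
        "M = lift_tiling a b"
        using positive_frieze_path[OF assms M(1)] .
      then have "F = \<Phi> n (SL2Z_orbit vs)" using Phi_orbit[OF closed(2) n vs(2)] M by simp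
      with vs(1) show "F \<in> \<Phi> n ` C_plus_mod_SL2Z n" by (auto simp: C_plus_mod_SL2Z_def)
    qed
  qed
qed

end
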